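(* For every integer $k\ge1$, the set $$\left\{\boldsymbol{\lambda}\in(0,\infty)^k:\ \mathcal{H}_{\boldsymbol{\lambda}}\text{ is unstable}\right\}$$ is open in $(0,\infty)^k$.
   Context: For $\boldsymbol{\lambda}\in(0,\infty)^k$, the generalized helicoid $\mathcal{H}_{\boldsymbol{\lambda}}\subset\mathbb{C}^k\times\mathbb{R}\cong\mathbb{R}^{2k+1}$ is the $(k+1)$-dimensional minimal submanifold parametrized by $(u_1,\dots,u_k,s)\mapsto(u_1e^{i\lambda_1s},\dots,u_ke^{i\lambda_ks},s)$, $(u,s)\in\mathbb{R}^k\times\mathbb{R}$. The second variation of area in the direction of a smooth compactly supported normal vector field $V$ on a minimal submanifold $M$ of Euclidean space is $$Q(V,V)=\int_{M}\Big(\sum_{a}|\nabla^\perp_{E_a}V|^2-\sum_{a,b}\langle \mathrm{II}(E_a,E_b),V\rangle^2\Big)\,d\mu_M,$$ where $\{E_a\}$ is any local orthonormal tangent frame, $\nabla^\perp$ is the normal connection, and $\mathrm{II}$ is the second fundamental form. $M$ is stable if $Q(V,V)\ge0$ for every such $V$, and unstable otherwise. *)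

theory Defs
  imports "HOL-Analysis.Analysis"
begin

section \<open>Smooth maps\<close>

primrec Ck_map :: "nat \<Rightarrow> ('a::real_normed_vector \<Rightarrow> 'b::real_normed_vector) \<Rightarrow> bool" where
  "Ck_map 0 f \<longleftrightarrow> continuous_on UNIV f"
| "Ck_map (Suc n) f \<longleftrightarrow>
     (\<forall>x. f differentiable (at x)) \<and> (\<forall>v. Ck_map n (\<lambda>x. frechet_derivative f (at x) v))"

definition smooth_map :: "('a::real_normed_vector \<Rightarrow> 'b::real_normed_vector) \<Rightarrow> bool" where
  "smooth_map f \<longleftrightarrow> (\<forall>n. Ck_map n f)"


section \<open>Second variation of area of a parametrized submanifold\<close>

text \<open>
  A submanifold \<open>M\<close> of a Euclidean space that is covered by one global chart is represented by
  its parametrization \<open>F :: real ^ 'm \<Rightarrow> 'n\<close>, an injective immersion that is a homeomorphism onto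
  \<open>M = range F\<close>. Functions and vector fields on \<open>M\<close> are pulled back along \<open>F\<close>, so a vector field
  along \<open>M\<close> is a map \<open>V :: real ^ 'm \<Rightarrow> 'n\<close>, with \<open>V x\<close> a vector at the point \<open>F x\<close>, and it is
  smooth (compactly supported) on \<open>M\<close> iff \<open>V\<close> is smooth (compactly supported) on \<open>real ^ 'm\<close>.
  Tangent vectors of \<open>M\<close> at \<open>F x\<close> are written as \<open>differential F x v\<close>.
\<close>

abbreviation differential ::
    "(real ^ 'm \<Rightarrow> 'n::euclidean_space) \<Rightarrow> real ^ 'm \<Rightarrow> real ^ 'm \<Rightarrow> 'n" where
  "differential F x \<equiv> frechet_derivative F (at x)"

definition tangent_space ::
    "(real ^ 'm \<Rightarrow> 'n::euclidean_space) \<Rightarrow> real ^ 'm \<Rightarrow> 'n set" where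
  "tangent_space F x = range (differential F x)"

definition normal_space_at ::
    "(real ^ 'm \<Rightarrow> 'n::euclidean_space) \<Rightarrow> real ^ 'm \<Rightarrow> 'n set" where
  "normal_space_at F x = orthogonal_comp (tangent_space F x)"

definition normal_part ::
    "(real ^ 'm \<Rightarrow> 'n::euclidean_space) \<Rightarrow> real ^ 'm \<Rightarrow> 'n \<Rightarrow> 'n" where
  "normal_part F x w = (THE n. n \<in> normal_space_at F x \<and> w - n \<in> tangent_space F x)"

text \<open>The normal connection, in the direction \<open>differential F x v\<close>.\<close>

definition normal_connection ::
    "(real ^ 'm \<Rightarrow> 'n::euclidean_space) \<Rightarrow> (real ^ 'm \<Rightarrow> 'n) \<Rightarrow> real ^ 'm \<Rightarrow> real ^ 'm \<Rightarrow> 'n" where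
  "normal_connection F V x v = normal_part F x (differential V x v)"

text \<open>
  The second fundamental form on \<open>differential F x v\<close> and \<open>differential F x w\<close>: the normal part of
  the derivative, in the first direction, of a tangent field extending the second vector, here
  \<open>\<lambda>y. differential F y w\<close>.
\<close>

definition second_fundamental_form ::
    "(real ^ 'm \<Rightarrow> 'n::euclidean_space) \<Rightarrow> real ^ 'm \<Rightarrow> real ^ 'm \<Rightarrow> real ^ 'm \<Rightarrow> 'n" where
  "second_fundamental_form F x v w =
     normal_part F x (differential (\<lambda>y. differential F y w) x v)"

text \<open>
  The vectors \<open>e a\<close> live in the parameter domain; the tangent frame proper consists of the
  vectors \<open>E\<^sub>a = differential F x (e a)\<close>.
\<close>

definition orthonormal_tangent_frame ::
    "(real ^ 'm \<Rightarrow> 'n::euclidean_space) \<Rightarrow> real ^ 'm \<Rightarrow> ('m \<Rightarrow> real ^ 'm) \<Rightarrow> bool" where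
  "orthonormal_tangent_frame F x e \<longleftrightarrow>
     (\<forall>a b. differential F x (e a) \<bullet> differential F x (e b) = (if a = b then 1 else 0))"

definition frame_integrand ::
    "(real ^ 'm \<Rightarrow> 'n::euclidean_space) \<Rightarrow> (real ^ 'm \<Rightarrow> 'n) \<Rightarrow> real ^ 'm \<Rightarrow> ('m \<Rightarrow> real ^ 'm) \<Rightarrow> real" where
  "frame_integrand F V x e =
     (\<Sum>a\<in>UNIV. (norm (normal_connection F V x (e a)))\<^sup>2) -
     (\<Sum>a\<in>UNIV. \<Sum>b\<in>UNIV. (second_fundamental_form F x (e a) (e b) \<bullet> V x)\<^sup>2)"

text \<open>
  The choice of the frame is immaterial, see \<open>second_variation_integrand_eq\<close> below; a frame exists
  wherever \<open>F\<close> is immersive, see \<open>orthonormal_tangent_frame_exists\<close>.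
\<close>

definition second_variation_integrand ::
    "(real ^ 'm \<Rightarrow> 'n::euclidean_space) \<Rightarrow> (real ^ 'm \<Rightarrow> 'n) \<Rightarrow> real ^ 'm \<Rightarrow> real" where
  "second_variation_integrand F V x =
     frame_integrand F V x (SOME e. orthonormal_tangent_frame F x e)"

definition gram_matrix ::
    "(real ^ 'm \<Rightarrow> 'n::euclidean_space) \<Rightarrow> real ^ 'm \<Rightarrow> real ^ 'm ^ 'm" where
  "gram_matrix F x = (\<chi> i j. differential F x (axis i 1) \<bullet> differential F x (axis j 1))"

text \<open>The volume measure of \<open>M\<close> is \<open>sqrt (det (gram_matrix F x)) dx\<close> in the chart.\<close>

definition second_variation ::
    "(real ^ 'm \<Rightarrow> 'n::euclidean_space) \<Rightarrow> (real ^ 'm \<Rightarrow> 'n) \<Rightarrow> real" where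
  "second_variation F V =
     (LINT x|lborel. second_variation_integrand F V x * sqrt (det (gram_matrix F x)))"

definition admissible_variation ::
    "(real ^ 'm \<Rightarrow> 'n::euclidean_space) \<Rightarrow> (real ^ 'm \<Rightarrow> 'n) \<Rightarrow> bool" where
  "admissible_variation F V \<longleftrightarrow>
     smooth_map V \<and> compact (closure {x. V x \<noteq> 0}) \<and> (\<forall>x. V x \<in> normal_space_at F x)"

definition stable :: "(real ^ 'm \<Rightarrow> 'n::euclidean_space) \<Rightarrow> bool" where
  "stable F \<longleftrightarrow> (\<forall>V. admissible_variation F V \<longrightarrow> 0 \<le> second_variation F V)"

abbreviation unstable :: "(real ^ 'm \<Rightarrow> 'n::euclidean_space) \<Rightarrow> bool" where
  "unstable F \<equiv> \<not> stable F"


section \<open>Independence of the frame\<close>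

lemma sum_inner_change_of_frame:
  fixes D :: "real ^ 'm \<Rightarrow> 'n::euclidean_space" and L M :: "real ^ 'm \<Rightarrow> 'c::real_inner" and e e' :: "'m \<Rightarrow> real ^ 'm"
  assumes D: "linear D" and L: "linear L" and M: "linear M"
    and e: "\<And>a b. D (e a) \<bullet> D (e b) = (if a = b then 1 else 0)"
    and e': "\<And>a b. D (e' a) \<bullet> D (e' b) = (if a = b then 1 else 0)"
  shows "(\<Sum>a\<in>UNIV. L (e' a) \<bullet> M (e' a)) = (\<Sum>a\<in>(UNIV::'m set). L (e a) \<bullet> M (e a))"
proof -
  have inj: "inj e"
    using e by (intro injI) (metis zero_neq_one)
  have De0: "D (\<Sum>a\<in>UNIV. c a *\<^sub>R e a) \<bullet> D (e b) = c b" for c :: "'m \<Rightarrow> real" and b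
    by (simp add: linear_sum[OF D] linear_scale[OF D] inner_sum_left e if_distrib
        cong: if_cong)
  have indep: "independent (range e)"
  proof (rule independent_if_scalars_zero)
    show "finite (range e)" by simp
    fix f x assume z: "(\<Sum>x\<in>range e. f x *\<^sub>R x) = 0" and "x \<in> range e"
    then obtain b where b: "x = e b" by blast
    have "(\<Sum>a\<in>UNIV. f (e a) *\<^sub>R e a) = 0"
      using z by (simp add: sum.reindex[OF inj])
    then show "f x = 0"
      using De0[of "\<lambda>a. f (e a)" b] b by (simp add: linear_0[OF D])
  qed
  have "span (range e) = UNIV"
    using card_eq_dim[of "range e" UNIV] indep inj
    by (auto simp: card_image)
  then have "\<forall>b. \<exists>c. e' b = (\<Sum>a\<in>UNIV. c a *\<^sub>R e a)"
    using span_finite[of "range e"] by (auto simp: sum.reindex[OF inj] o_def set_eq_iff image_iff)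
  then obtain c where c: "\<And>b. e' b = (\<Sum>a\<in>UNIV. c b a *\<^sub>R e a)"
    by metis
  define m where "m = (\<chi> b a. c b a)"
  have "(\<Sum>a\<in>UNIV. c b a * c d a) = (if b = d then 1 else 0)" for b d
  proof -
    have "D (e' b) \<bullet> D (e' d) = (\<Sum>a\<in>UNIV. c d a * (D (e' b) \<bullet> D (e a)))"
      by (subst (2) c) (simp add: linear_sum[OF D] linear_scale[OF D] inner_sum_right)
    also have "\<dots> = (\<Sum>a\<in>UNIV. c b a * c d a)"
      by (simp add: c De0 mult.commute)
    finally show ?thesis using e' by simp
  qed
  then have "m ** transpose m = mat 1"
    by (simp add: m_def matrix_matrix_mult_def transpose_def mat_def)
  then have "transpose m ** m = mat 1"
    using matrix_left_right_inverse by blast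
  then have orth: "(\<Sum>b\<in>UNIV. c b a * c b d) = (if a = d then 1 else 0)" for a d
    by (simp add: m_def matrix_matrix_mult_def transpose_def mat_def vec_eq_iff)
  have "(\<Sum>b\<in>UNIV. L (e' b) \<bullet> M (e' b))
      = (\<Sum>b\<in>UNIV. \<Sum>a\<in>UNIV. \<Sum>d\<in>UNIV. (c b d * c b a) * (L (e d) \<bullet> M (e a)))"
    by (simp add: c linear_sum[OF L] linear_scale[OF L] linear_sum[OF M] linear_scale[OF M]
        inner_sum_left inner_sum_right sum_distrib_left mult_ac)
  also have "\<dots> = (\<Sum>a\<in>UNIV. \<Sum>d\<in>UNIV. \<Sum>b\<in>UNIV. (c b d * c b a) * (L (e d) \<bullet> M (e a)))"
    by (subst sum.swap, rule sum.cong[OF refl], subst sum.swap, rule refl)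
  also have "\<dots> = (\<Sum>a\<in>UNIV. \<Sum>d\<in>UNIV. (if d = a then 1 else 0) * (L (e d) \<bullet> M (e a)))"
    by (simp add: orth flip: sum_distrib_right)
  also have "\<dots> = (\<Sum>a\<in>UNIV. L (e a) \<bullet> M (e a))"
    by (simp add: if_distrib if_distribR cong: if_cong)
  finally show ?thesis .
qed

lemma normal_part_unique:
  assumes D: "linear (differential F x)"
  shows "\<exists>!n. n \<in> normal_space_at F x \<and> w - n \<in> tangent_space F x"
proof -
  have sub: "subspace (tangent_space F x)"
    unfolding tangent_space_def by (intro linear_subspace_image D subspace_UNIV)
  obtain t n where tn: "t \<in> tangent_space F x" "n \<in> normal_space_at F x" "w = t + n"
    using subspace_sum_orthogonal_comp[OF sub] unfolding normal_space_at_def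
    by (metis UNIV_I set_plus_elim)
  have "n' = n" if "n' \<in> normal_space_at F x" "w - n' \<in> tangent_space F x" for n'
  proof -
    have "n' - n \<in> normal_space_at F x"
      using that tn unfolding normal_space_at_def by (simp add: subspace_diff subspace_orthogonal_comp)
    moreover have "(w - n) - (w - n') \<in> tangent_space F x"
      by (rule subspace_diff[OF sub]) (use that tn in auto)
    then have "n' - n \<in> tangent_space F x" by simp
    ultimately have "orthogonal (n' - n) (n' - n)"
      by (simp add: normal_space_at_def orthogonal_comp_def)
    then show ?thesis by (simp add: orthogonal_self)
  qed
  then show ?thesis using tn by (intro ex1I[of _ n]) auto
qed

lemma normal_part_eqI:
  assumes "linear (differential F x)" "n \<in> normal_space_at F x" "w - n \<in> tangent_space F x"
  shows "normal_part F x w = n"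
  unfolding normal_part_def
  by (rule the1_equality[OF normal_part_unique]) (use assms in auto)

lemma linear_normal_part:
  assumes D: "linear (differential F x)"
  shows "linear (normal_part F x)"
proof -
  have T: "subspace (tangent_space F x)"
    unfolding tangent_space_def by (intro linear_subspace_image D subspace_UNIV)
  have N: "subspace (normal_space_at F x)"
    unfolding normal_space_at_def by (rule subspace_orthogonal_comp)
  have P: "normal_part F x w \<in> normal_space_at F x \<and> w - normal_part F x w \<in> tangent_space F x" for w
    unfolding normal_part_def by (rule theI'[OF normal_part_unique[OF D]])
  show ?thesis
  proof (rule linearI)
    fix v w
    have "(v - normal_part F x v) + (w - normal_part F x w) \<in> tangent_space F x"
      using P T by (blast intro: subspace_add)
    then show "normal_part F x (v + w) = normal_part F x v + normal_part F x w"
      using P N by (intro normal_part_eqI D) (auto intro: subspace_add simp: algebra_simps)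
  next
    fix r w
    have "r *\<^sub>R (w - normal_part F x w) \<in> tangent_space F x"
      using P T by (blast intro: subspace_scale)
    then show "normal_part F x (r *\<^sub>R w) = r *\<^sub>R normal_part F x w"
      using P N by (intro normal_part_eqI D) (auto intro: subspace_scale simp: algebra_simps)
  qed
qed

lemma smooth_map_differentiable:
  assumes "smooth_map f" shows "f differentiable (at x)"
  using assms unfolding smooth_map_def by (metis Ck_map.simps(2))

lemma smooth_map_differential:
  assumes "smooth_map f" shows "smooth_map (\<lambda>x. frechet_derivative f (at x) v)"
  using assms unfolding smooth_map_def by (metis Ck_map.simps(2))

lemma second_fundamental_form_linear_right:
  fixes F :: "real ^ 'm \<Rightarrow> 'n::euclidean_space"
  assumes F: "smooth_map F"
  shows "linear (second_fundamental_form F x v)"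
proof -
  note dF = smooth_map_differentiable[OF F]
  note ddF = smooth_map_differentiable[OF smooth_map_differential[OF F]]
  note lin = linear_frechet_derivative[OF dF]
  have a: "differential (\<lambda>y. differential F y (w + w')) x v =
        differential (\<lambda>y. differential F y w) x v + differential (\<lambda>y. differential F y w') x v"
    for w w'
  proof -
    have "((\<lambda>y. differential F y w + differential F y w') has_derivative
        (\<lambda>h. differential (\<lambda>y. differential F y w) x h + differential (\<lambda>y. differential F y w') x h)) (at x)"
      by (intro has_derivative_add frechet_derivative_works[THEN iffD1] ddF)
    from frechet_derivative_at[OF this] show ?thesis
      by (simp add: linear_add[OF lin] fun_eq_iff)
  qed
  have s: "differential (\<lambda>y. differential F y (r *\<^sub>R w)) x v =
        r *\<^sub>R differential (\<lambda>y. differential F y w) x v" for r w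
  proof -
    have "((\<lambda>y. r *\<^sub>R differential F y w) has_derivative
           (\<lambda>h. r *\<^sub>R differential (\<lambda>y. differential F y w) x h)) (at x)"
      by (intro has_derivative_scaleR_right frechet_derivative_works[THEN iffD1] ddF)
    from frechet_derivative_at[OF this] show ?thesis
      by (simp add: linear_scale[OF lin] fun_eq_iff)
  qed
  have N: "linear (normal_part F x)" by (rule linear_normal_part[OF lin])
  show ?thesis
    unfolding second_fundamental_form_def
    by (rule linearI) (simp_all add: a s linear_add[OF N] linear_scale[OF N])
qed

lemma frame_integrand_independent:
  fixes F V :: "real ^ 'm \<Rightarrow> 'n::euclidean_space"
  assumes F: "smooth_map F" and V: "smooth_map V"
    and e: "orthonormal_tangent_frame F x e" and e': "orthonormal_tangent_frame F x e'"
  shows "frame_integrand F V x e' = frame_integrand F V x e"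
proof -
  note D = linear_frechet_derivative[OF smooth_map_differentiable[OF F]]
  note DV = linear_frechet_derivative[OF smooth_map_differentiable[OF V]]
  note DDF = linear_frechet_derivative[OF smooth_map_differentiable[OF smooth_map_differential[OF F]]]
  have N: "linear (normal_part F x)" by (rule linear_normal_part[OF D])
  have lin_nc: "linear (normal_connection F V x)"
    using linear_compose[OF DV N] by (simp add: o_def normal_connection_def[abs_def])
  have "linear (\<lambda>v. second_fundamental_form F x v w)" for w
    using linear_compose[OF DDF N] by (simp add: o_def second_fundamental_form_def)
  then have l: "linear (\<lambda>v. second_fundamental_form F x v w \<bullet> V x)" for w
    by (simp add: linear_iff inner_add_left)
  have r: "linear (\<lambda>w. second_fundamental_form F x v w \<bullet> V x)" for v
    using second_fundamental_form_linear_right[OF F, of x v] by (simp add: linear_iff inner_add_left)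
  note fr = e[unfolded orthonormal_tangent_frame_def, rule_format]
    e'[unfolded orthonormal_tangent_frame_def, rule_format]
  let ?b = "\<lambda>v w. (second_fundamental_form F x v w \<bullet> V x)\<^sup>2"
  have 1: "(\<Sum>a\<in>UNIV. (norm (normal_connection F V x (e' a)))\<^sup>2) =
      (\<Sum>a\<in>UNIV. (norm (normal_connection F V x (e a)))\<^sup>2)"
    unfolding power2_norm_eq_inner by (rule sum_inner_change_of_frame[OF D lin_nc lin_nc fr])
  have 2: "(\<Sum>b\<in>UNIV. ?b v (e' b)) = (\<Sum>b\<in>UNIV. ?b v (e b))" for v
    using sum_inner_change_of_frame[OF D r r fr, of v] by (simp add: power2_eq_square)
  have 3: "(\<Sum>a\<in>UNIV. ?b (e' a) w) = (\<Sum>a\<in>UNIV. ?b (e a) w)" for w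
    using sum_inner_change_of_frame[OF D l l fr, of w] by (simp add: power2_eq_square)
  have "(\<Sum>a\<in>UNIV. \<Sum>b\<in>UNIV. ?b (e' a) (e' b)) = (\<Sum>a\<in>UNIV. \<Sum>b\<in>UNIV. ?b (e' a) (e b))"
    by (simp add: 2)
  also have "\<dots> = (\<Sum>b\<in>UNIV. \<Sum>a\<in>UNIV. ?b (e a) (e b))"
    by (subst sum.swap) (simp add: 3)
  also have "\<dots> = (\<Sum>a\<in>UNIV. \<Sum>b\<in>UNIV. ?b (e a) (e b))"
    by (rule sum.swap)
  finally show ?thesis by (simp add: frame_integrand_def 1)
qed

lemma second_variation_integrand_eq:
  fixes F V :: "real ^ 'm \<Rightarrow> 'n::euclidean_space"
  assumes "smooth_map F" "smooth_map V" "orthonormal_tangent_frame F x e"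
  shows "second_variation_integrand F V x = frame_integrand F V x e"
  unfolding second_variation_integrand_def
  using frame_integrand_independent[OF assms(1,2,3)] someI[of "orthonormal_tangent_frame F x", OF assms(3)]
  by blast

lemma orthonormal_tangent_frame_exists:
  fixes F :: "real ^ 'm \<Rightarrow> 'n::euclidean_space"
  assumes F: "F differentiable (at x)" and inj: "inj (differential F x)"
  shows "\<exists>e. orthonormal_tangent_frame F x e"
proof -
  note D = linear_frechet_derivative[OF F]
  have sub: "subspace (tangent_space F x)"
    unfolding tangent_space_def by (intro linear_subspace_image D subspace_UNIV)
  obtain B where B: "B \<subseteq> tangent_space F x" "pairwise orthogonal B" "\<And>y. y \<in> B \<Longrightarrow> norm y = 1"
      "independent B" "card B = dim (tangent_space F x)"
    using orthonormal_basis_subspace[OF sub] by metis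
  have "card B = CARD('m)"
    using B(5) dim_image_eq[OF D, of UNIV] inj by (simp add: tangent_space_def)
  moreover have "finite B" using B(4) by (rule independent_imp_finite)
  ultimately obtain h where h: "bij_betw h (UNIV :: 'm set) B"
    using finite_same_card_bij[of "UNIV :: 'm set" B] by auto
  have "\<forall>a. \<exists>v. differential F x v = h a"
    using h B(1) unfolding tangent_space_def bij_betw_def by (metis imageE rangeI subsetD)
  then obtain e where e: "\<And>a. differential F x (e a) = h a" by metis
  have "h a \<bullet> h b = (if a = b then 1 else 0)" for a b
    using B(2,3) h unfolding bij_betw_def inj_def pairwise_def orthogonal_def
    by (metis norm_eq_1 rangeI)
  then have "orthonormal_tangent_frame F x e"
    unfolding orthonormal_tangent_frame_def e by blast
  then show ?thesis by blast
qed


section \<open>Generalized helicoids\<close>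

text \<open>
  The parameter space \<open>\<real>\<^sup>k \<times> \<real>\<close> is \<open>real ^ ('k option)\<close>: the coordinate of \<open>p\<close> at \<open>Some j\<close> is
  \<open>u\<^sub>j\<close> and the one at \<open>None\<close> is \<open>s\<close>.
\<close>

definition helicoid ::
    "real ^ 'k \<Rightarrow> real ^ ('k option) \<Rightarrow> (complex ^ 'k) \<times> real" where
  "helicoid lam p =
     (\<chi> j. complex_of_real (p $ Some j) * exp (\<i> * complex_of_real (lam $ j * p $ None)), p $ None)"

text \<open>
  The parametrization is a closed embedding and an immersion: \<open>helicoid_retraction lam\<close> is a
  differentiable left inverse of it on the whole ambient space.
\<close>

definition helicoid_retraction ::
    "real ^ 'k \<Rightarrow> (complex ^ 'k) \<times> real \<Rightarrow> real ^ ('k option)" where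
  "helicoid_retraction lam q =
     (\<chi> i. case i of None \<Rightarrow> snd q
        | Some j \<Rightarrow> Re (fst q $ j * exp (- (\<i> * complex_of_real (lam $ j * snd q)))))"

lemma helicoid_retraction: "helicoid_retraction lam (helicoid lam p) = p"
proof -
  have *: "exp (\<i> * of_real t) * exp (- (\<i> * of_real t)) = 1" for t :: real
    by (simp flip: exp_add)
  have "Re ((of_real r * exp (\<i> * of_real t)) * exp (- (\<i> * of_real t))) = r" for r t
    using *[of t] by (metis Re_complex_of_real mult.assoc mult.right_neutral)
  then show ?thesis
    by (auto simp: helicoid_retraction_def helicoid_def vec_eq_iff
        simp del: of_real_mult times_complex.sel split: option.split)
qed

lemma differentiable_vec:
  fixes f :: "'a::real_normed_vector \<Rightarrow> 'b::euclidean_space ^ 'k"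
  assumes "\<And>i. (\<lambda>x. f x $ i) differentiable (at x)"
  shows "f differentiable (at x)"
proof -
  have "linear (axis i :: 'b \<Rightarrow> 'b ^ 'k)" for i
    by (rule linearI) (auto simp: axis_def vec_eq_iff)
  then have "bounded_linear (axis i :: 'b \<Rightarrow> 'b ^ 'k)" for i
    by (simp add: linear_conv_bounded_linear)
  then have "(\<lambda>x. axis i (f x $ i)) differentiable (at x)" for i
    using assms[of i] unfolding differentiable_def by (blast dest: bounded_linear.has_derivative)
  then have "(\<lambda>x. \<Sum>i\<in>UNIV. axis i (f x $ i)) differentiable (at x)"
    by (intro differentiable_sum) auto
  moreover have "(\<Sum>i\<in>UNIV. axis i (f x $ i)) = f x" for x
    by (simp add: vec_eq_iff axis_def sum_component if_distrib cong: if_cong)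
  ultimately show ?thesis by simp
qed

lemma differentiable_exp_i:
  fixes g :: "'a::real_normed_vector \<Rightarrow> real"
  assumes "g differentiable (at x)"
  shows "(\<lambda>x. exp (c * complex_of_real (g x))) differentiable (at x)"
proof -
  obtain g' where "(g has_derivative g') (at x)"
    using assms unfolding differentiable_def by blast
  then have "((\<lambda>x. c * complex_of_real (g x)) has_derivative (\<lambda>h. c * complex_of_real (g' h))) (at x)"
    by (auto intro!: derivative_eq_intros has_derivative_of_real)
  from has_derivative_compose[OF this DERIV_exp[unfolded has_field_derivative_def]]
  show ?thesis unfolding differentiable_def by blast
qed

lemma differentiable_bounded_linear:
  "bounded_linear f \<Longrightarrow> g differentiable (at x) \<Longrightarrow> (\<lambda>x. f (g x)) differentiable (at x)"
  unfolding differentiable_def by (blast dest: bounded_linear.has_derivative)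

lemma helicoid_differentiable:
  fixes lam :: "real ^ 'k"
  shows "helicoid lam differentiable (at p)"
proof -
  have c: "(\<lambda>p :: real ^ ('k option). p $ i) differentiable (at p)" for i p
    by (intro bounded_linear_imp_differentiable bounded_linear_vec_nth)
  have 1: "(\<lambda>p. \<chi> j. complex_of_real (p $ Some j) * exp (\<i> * complex_of_real (lam $ j * p $ None)))
      differentiable (at p)"
    by (intro differentiable_vec)
      (simp del: of_real_mult, intro differentiable_mult differentiable_exp_i differentiable_const c
        differentiable_bounded_linear[OF bounded_linear_of_real])
  obtain A B where "((\<lambda>p. \<chi> j. complex_of_real (p $ Some j) *
      exp (\<i> * complex_of_real (lam $ j * p $ None))) has_derivative A) (at p)"
    "((\<lambda>p. p $ None) has_derivative B) (at p)"
    using 1 c unfolding differentiable_def by blast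
  from has_derivative_Pair[OF this] show ?thesis
    unfolding differentiable_def helicoid_def[abs_def] by blast
qed

lemma helicoid_retraction_differentiable:
  fixes lam :: "real ^ 'k"
  shows "helicoid_retraction lam differentiable (at q)"
proof (rule differentiable_vec)
  fix i
  have s: "(\<lambda>q :: (complex ^ 'k) \<times> real. snd q) differentiable (at q)"
    by (intro bounded_linear_imp_differentiable bounded_linear_snd)
  have f: "(\<lambda>q :: (complex ^ 'k) \<times> real. fst q $ j) differentiable (at q)" for j
    by (intro differentiable_bounded_linear[OF bounded_linear_vec_nth]
        bounded_linear_imp_differentiable bounded_linear_fst)
  have "(\<lambda>q. Re (fst q $ j * exp ((- \<i>) * complex_of_real (lam $ j * snd q)))) differentiable (at q)"
    for j
    by (intro differentiable_bounded_linear[OF bounded_linear_Re] differentiable_mult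
        differentiable_exp_i differentiable_const s f)
  with s show "(\<lambda>q. helicoid_retraction lam q $ i) differentiable (at q)"
    by (cases i) (simp_all add: helicoid_retraction_def del: of_real_mult times_complex.sel)
qed

lemma inj_differential_helicoid: "inj (differential (helicoid lam) p)"
proof -
  let ?D = "differential (helicoid lam) p"
  let ?E = "frechet_derivative (helicoid_retraction lam) (at (helicoid lam p))"
  have "((helicoid_retraction lam \<circ> helicoid lam) has_derivative (?E \<circ> ?D)) (at p)"
    by (intro diff_chain_at frechet_derivative_works[THEN iffD1] helicoid_differentiable
        helicoid_retraction_differentiable)
  moreover have "helicoid_retraction lam \<circ> helicoid lam = (\<lambda>p. p)"
    by (simp add: fun_eq_iff helicoid_retraction)
  ultimately have "?E \<circ> ?D = (\<lambda>v. v)"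
    by (metis has_derivative_ident has_derivative_unique)
  then show ?thesis
    by (metis comp_apply injI)
qed

end

theory Submission
  imports Defs
begin

text \<open>
  The normal bundles of all helicoids are trivialized simultaneously: a vector normal to the
  helicoid of \<open>lam\<close> at the parameter \<open>p\<close> is \<open>normal_vector lam p a\<close> for a unique \<open>a \<in> \<real>\<^sup>k\<close>. Hence an
  admissible variation of one helicoid is a compactly supported smooth function \<open>a\<close>, and the same
  \<open>a\<close> is an admissible variation of every other helicoid. For fixed \<open>a\<close>, the integrand of the
  second variation is jointly continuous in \<open>lam\<close> and \<open>p\<close> and supported in a fixed box, so the second
  variation is continuous in \<open>lam\<close> and remains negative near any \<open>lam\<close> at which it is negative.
\<close>

section \<open>Closure properties of smooth maps\<close>

lemma Ck_map_SucD: "Ck_map (Suc n) f \<Longrightarrow> Ck_map n f"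
proof (induction n arbitrary: f)
  case 0
  then show ?case
    by (auto intro!: continuous_at_imp_continuous_on differentiable_imp_continuous_within)
next
  case (Suc n)
  then show ?case by (metis Ck_map.simps(2))
qed

text \<open>Uniqueness of the derivative lets any explicit candidate \<open>f'\<close> replace
  \<open>frechet_derivative\<close>, so smoothness proofs reduce to differentiation rules.\<close>

lemma Ck_map_SucI:
  assumes "\<And>x. (f has_derivative f' x) (at x)" and "\<And>v. Ck_map n (\<lambda>x. f' x v)"
  shows "Ck_map (Suc n) f"
proof -
  have "frechet_derivative f (at x) = f' x" for x
    using frechet_derivative_at[OF assms(1)] by simp
  then show ?thesis
    using assms by (auto simp: differentiable_def)
qed

lemma Ck_map_SucE:
  assumes "Ck_map (Suc n) f"
  obtains f' where "\<And>x. (f has_derivative f' x) (at x)" "\<And>v. Ck_map n (\<lambda>x. f' x v)"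
  using assms frechet_derivative_works by (metis Ck_map.simps(2))

lemma Ck_map_const: "Ck_map n (\<lambda>x. c)"
  by (induction n arbitrary: c) (auto intro: Ck_map_SucI[where f' = "\<lambda>_ _. 0"])

lemma Ck_map_linear: "bounded_linear h \<Longrightarrow> Ck_map n h"
  by (cases n)
    (auto intro!: Ck_map_SucI[where f' = "\<lambda>_. h"] Ck_map_const linear_continuous_on
      bounded_linear_imp_has_derivative simp del: Ck_map.simps(2))

lemma Ck_map_linear_comp:
  assumes h: "bounded_linear h"
  shows "Ck_map n f \<Longrightarrow> Ck_map n (\<lambda>x. h (f x))"
proof (induction n arbitrary: f)
  case 0
  then show ?case by (simp add: bounded_linear.continuous_on[OF h])
next
  case (Suc n)
  from Suc.prems obtain f' where "\<And>x. (f has_derivative f' x) (at x)" "\<And>v. Ck_map n (\<lambda>x. f' x v)"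
    by (rule Ck_map_SucE) blast
  then show ?case
    by (intro Ck_map_SucI[where f' = "\<lambda>x v. h (f' x v)"] bounded_linear.has_derivative[OF h] Suc.IH)
qed

lemma Ck_map_add: "Ck_map n f \<Longrightarrow> Ck_map n g \<Longrightarrow> Ck_map n (\<lambda>x. f x + g x)"
proof (induction n arbitrary: f g)
  case 0
  then show ?case by (simp add: continuous_on_add)
next
  case (Suc n)
  from Suc.prems(1) obtain f' where "\<And>x. (f has_derivative f' x) (at x)" "\<And>v. Ck_map n (\<lambda>x. f' x v)"
    by (rule Ck_map_SucE) blast
  moreover from Suc.prems(2) obtain g' where "\<And>x. (g has_derivative g' x) (at x)"
      "\<And>v. Ck_map n (\<lambda>x. g' x v)"
    by (rule Ck_map_SucE) blast
  ultimately show ?case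
    by (intro Ck_map_SucI[where f' = "\<lambda>x v. f' x v + g' x v"] has_derivative_add Suc.IH)
qed

lemma Ck_map_sum: "(\<And>i. i \<in> I \<Longrightarrow> Ck_map n (f i)) \<Longrightarrow> Ck_map n (\<lambda>x. \<Sum>i\<in>I. f i x)"
  by (induction I rule: infinite_finite_induct) (auto intro: Ck_map_add Ck_map_const)

text \<open>The Leibniz rule leaves \<open>f\<close> and \<open>g\<close> themselves beside their
  derivatives; \<open>Ck_map_SucD\<close> lowers their order so that the induction hypothesis covers
  both summands.\<close>

lemma Ck_map_bilinear:
  assumes B: "bounded_bilinear B"
  shows "Ck_map n f \<Longrightarrow> Ck_map n g \<Longrightarrow> Ck_map n (\<lambda>x. B (f x) (g x))"
proof (induction n arbitrary: f g)
  case 0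
  then show ?case by (simp add: bounded_bilinear.continuous_on[OF B])
next
  case (Suc n)
  note fg = Suc.prems[THEN Ck_map_SucD]
  from Suc.prems(1) obtain f' where "\<And>x. (f has_derivative f' x) (at x)" "\<And>v. Ck_map n (\<lambda>x. f' x v)"
    by (rule Ck_map_SucE) blast
  moreover from Suc.prems(2) obtain g' where "\<And>x. (g has_derivative g' x) (at x)"
      "\<And>v. Ck_map n (\<lambda>x. g' x v)"
    by (rule Ck_map_SucE) blast
  ultimately show ?case using fg
    by (intro Ck_map_SucI[where f' = "\<lambda>x v. B (f x) (g' x v) + B (f' x v) (g x)"]
        bounded_bilinear.FDERIV[OF B] Ck_map_add Suc.IH)
qed

text \<open>The derivative of \<open>cis (f x)\<close> contains \<open>cis (f x)\<close> again, but
  there only order \<open>n\<close> is needed, which the induction hypothesis supplies.\<close>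

lemma Ck_map_cis: "Ck_map n f \<Longrightarrow> Ck_map n (\<lambda>x. cis (f x))"
proof (induction n)
  case 0
  then show ?case by (simp add: continuous_on_cis)
next
  case (Suc n)
  note f = Suc.prems[THEN Ck_map_SucD]
  from Suc.prems obtain f' where "\<And>x. (f has_derivative f' x) (at x)" "\<And>v. Ck_map n (\<lambda>x. f' x v)"
    by (rule Ck_map_SucE) blast
  then show ?case using f
    by (intro Ck_map_SucI[where f' = "\<lambda>x v. f' x v *\<^sub>R (\<i> * cis (f x))"] has_derivative_cis
        Ck_map_bilinear[OF bounded_bilinear_scaleR] Ck_map_bilinear[OF bounded_bilinear_mult]
        Ck_map_const Suc.IH)
qed

lemma bounded_linear_axis: "bounded_linear (axis i :: 'b::euclidean_space \<Rightarrow> 'b ^ 'k)"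
proof -
  have "linear (axis i :: 'b \<Rightarrow> 'b ^ 'k)"
    by (rule linearI) (auto simp: axis_def vec_eq_iff)
  then show ?thesis by (simp add: linear_conv_bounded_linear)
qed

text \<open>Reduces rules for vectors given by components to those for finite sums and bounded
  linear maps.\<close>

lemma vec_lambda_eq_sum_axis: "(\<chi> i. f i) = (\<Sum>i\<in>UNIV. axis i (f i :: 'b::euclidean_space))"
  by (simp add: vec_eq_iff axis_def sum_component if_distrib cong: if_cong)

lemma Ck_map_vec:
  fixes f :: "'k::finite \<Rightarrow> 'a::real_normed_vector \<Rightarrow> 'b::euclidean_space"
  assumes "\<And>i. Ck_map n (f i)"
  shows "Ck_map n (\<lambda>x. \<chi> i. f i x)"
  unfolding vec_lambda_eq_sum_axis
  by (intro Ck_map_sum Ck_map_linear_comp[OF bounded_linear_axis] assms)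

lemma has_derivative_vec:
  fixes f :: "'k::finite \<Rightarrow> 'a::real_normed_vector \<Rightarrow> 'b::euclidean_space"
  assumes "\<And>i. (f i has_derivative f' i) F"
  shows "((\<lambda>x. \<chi> i. f i x) has_derivative (\<lambda>h. \<chi> i. f' i h)) F"
  unfolding vec_lambda_eq_sum_axis
  by (intro has_derivative_sum bounded_linear.has_derivative[OF bounded_linear_axis] assms)

lemma Ck_map_Pair:
  assumes "Ck_map n f" "Ck_map n g"
  shows "Ck_map n (\<lambda>x. (f x, g x))"
proof -
  have "Ck_map n (\<lambda>x. (f x, 0) + (0, g x))"
    by (intro Ck_map_add Ck_map_linear_comp[of "\<lambda>y. (y, 0)"] Ck_map_linear_comp[of "\<lambda>y. (0, y)"]
        assms bounded_linear_Pair bounded_linear_ident bounded_linear_zero)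
  then show ?thesis by simp
qed

lemmas Ck_map_intros =
  Ck_map_const Ck_map_add Ck_map_sum Ck_map_cis Ck_map_vec Ck_map_Pair
  Ck_map_bilinear[OF bounded_bilinear_mult] Ck_map_linear_comp[OF bounded_linear_of_real]
  Ck_map_linear[OF bounded_linear_vec_nth] Ck_map_linear_comp[OF bounded_linear_minus[OF bounded_linear_ident]]


section \<open>Normal geometry of the helicoid\<close>

text \<open>An orthonormal frame has as many members as the dimension of the domain, so it spans the
  tangent space.\<close>

lemma normal_part_frame:
  fixes F :: "real ^ 'm \<Rightarrow> 'n::euclidean_space"
  assumes D: "linear (differential F x)" and e: "orthonormal_tangent_frame F x e"
  shows "normal_part F x w =
    w - (\<Sum>a\<in>UNIV. (w \<bullet> differential F x (e a)) *\<^sub>R differential F x (e a))" (is "_ = ?n")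
proof (rule normal_part_eqI[OF D])
  let ?E = "\<lambda>a. differential F x (e a)"
  note orth = e[unfolded orthonormal_tangent_frame_def, rule_format]
  have inj: "inj ?E"
    using orth by (intro injI) (metis zero_neq_one)
  have "?E a \<noteq> 0" for a
    using orth[of a a] by auto
  then have ind: "independent (range ?E)"
    by (intro pairwise_orthogonal_independent) (force simp: pairwise_def orthogonal_def orth)+
  have sub: "subspace (tangent_space F x)"
    unfolding tangent_space_def by (intro linear_subspace_image D subspace_UNIV)
  have "dim (tangent_space F x) \<le> CARD('m)"
    using dim_image_le[OF D, of UNIV] by (simp add: tangent_space_def)
  then have span: "tangent_space F x \<subseteq> span (range ?E)"
    by (intro card_ge_dim_independent ind) (auto simp: tangent_space_def card_image[OF inj])
  have "orthogonal ?n (?E b)" for b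
    by (simp add: orthogonal_def inner_diff_left inner_sum_left orth if_distrib cong: if_cong)
  then have "orthogonal ?n y" if "y \<in> tangent_space F x" for y
    using that span orthogonal_to_span[of y "range ?E" ?n] by auto
  then show "?n \<in> normal_space_at F x"
    by (simp add: normal_space_at_def orthogonal_comp_def orthogonal_commute)
  show "w - ?n \<in> tangent_space F x"
    by (auto simp: tangent_space_def intro!: subspace_sum[OF sub, unfolded tangent_space_def]
        subspace_scale[OF sub, unfolded tangent_space_def])
qed

section \<open>Explicit derivatives of the helicoid and of its normal fields\<close>

lemma helicoid_eq_cis:
  "helicoid lam p = (\<chi> j. complex_of_real (p $ Some j) * cis (lam $ j * p $ None), p $ None)"
  by (simp add: helicoid_def cis_conv_exp)

text \<open>The rotation \<open>cis (lam $ j * p $ None)\<close> is kept as a right factor, so that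
  it cancels in inner products by \<open>inner_vec_cis\<close>.\<close>

definition helicoid_D ::
    "real ^ 'k \<Rightarrow> real ^ ('k option) \<Rightarrow> real ^ ('k option) \<Rightarrow> (complex ^ 'k) \<times> real" where
  "helicoid_D lam p v =
     (\<chi> j. Complex (v $ Some j) (lam $ j * p $ Some j * v $ None) * cis (lam $ j * p $ None), v $ None)"

definition helicoid_D2 ::
    "real ^ 'k \<Rightarrow> real ^ ('k option) \<Rightarrow> real ^ ('k option) \<Rightarrow> real ^ ('k option) \<Rightarrow> (complex ^ 'k) \<times> real" where
  "helicoid_D2 lam p v w =
     (\<chi> j. Complex (- (lam $ j)\<^sup>2 * p $ Some j * v $ None * w $ None)
        (lam $ j * (v $ Some j * w $ None + v $ None * w $ Some j)) * cis (lam $ j * p $ None), 0)"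

text \<open>The normal space of the helicoid at a point is parametrized by \<open>a \<in> \<real>\<^sup>k\<close>: its elements are the
  vectors \<open>(\<i> a\<^sub>j e\<^bsup>\<i>\<lambda>\<^sub>js\<^esup>)\<^sub>j\<close> in \<open>\<complex>\<^sup>k\<close>, with the last coordinate forced by orthogonality
  to \<open>\<partial>/\<partial>s\<close>.\<close>

definition normal_vector ::
    "real ^ 'k \<Rightarrow> real ^ ('k option) \<Rightarrow> real ^ 'k \<Rightarrow> (complex ^ 'k) \<times> real" where
  "normal_vector lam p a =
     (\<chi> j. Complex 0 (a $ j) * cis (lam $ j * p $ None), - (\<Sum>j\<in>UNIV. a $ j * lam $ j * p $ Some j))"

text \<open>Product rule for a normal field: \<open>a\<close> is the value of the coefficient
  function at \<open>p\<close>, and \<open>b\<close> is its derivative in the direction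
  \<open>v\<close>.\<close>

definition normal_vector_D ::
    "real ^ 'k \<Rightarrow> real ^ ('k option) \<Rightarrow> real ^ 'k \<Rightarrow> real ^ ('k option) \<Rightarrow> real ^ 'k \<Rightarrow> (complex ^ 'k) \<times> real" where
  "normal_vector_D lam p a v b =
     (\<chi> j. Complex (- (a $ j * lam $ j * v $ None)) (b $ j) * cis (lam $ j * p $ None),
      - (\<Sum>j\<in>UNIV. lam $ j * (b $ j * p $ Some j + a $ j * v $ Some j)))"

lemma Complex_eq_of_real: "Complex x y = complex_of_real x + \<i> * complex_of_real y"
  by (simp add: complex_eq_iff)

lemmas has_derivative_vec_nth = bounded_linear.has_derivative[OF bounded_linear_vec_nth]

lemma has_derivative_helicoid:
  "(helicoid lam has_derivative helicoid_D lam p) (at p)"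
  unfolding helicoid_eq_cis[abs_def] helicoid_D_def[abs_def]
  by (intro has_derivative_Pair has_derivative_vec)
    (auto intro!: derivative_eq_intros has_derivative_vec_nth
      simp: fun_eq_iff complex_eq_iff algebra_simps)

lemma has_derivative_helicoid_D:
  "((\<lambda>p. helicoid_D lam p w) has_derivative (\<lambda>v. helicoid_D2 lam p v w)) (at p)"
  unfolding helicoid_D_def[abs_def] helicoid_D2_def[abs_def] Complex_eq_of_real
  by (intro has_derivative_Pair has_derivative_vec)
    (auto intro!: derivative_eq_intros has_derivative_vec_nth
      simp: fun_eq_iff complex_eq_iff algebra_simps power2_eq_square)

lemma has_derivative_normal_vector:
  assumes "(a has_derivative a') (at p)"
  shows "((\<lambda>p. normal_vector lam p (a p)) has_derivative
    (\<lambda>v. normal_vector_D lam p (a p) v (a' v))) (at p)"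
  unfolding normal_vector_def[abs_def] normal_vector_D_def[abs_def] Complex_eq_of_real
  by (intro has_derivative_Pair has_derivative_vec has_derivative_minus)
    (auto intro!: derivative_eq_intros has_derivative_vec_nth assms sum.cong
      simp: fun_eq_iff complex_eq_iff algebra_simps)

lemma differential_helicoid: "differential (helicoid lam) p = helicoid_D lam p"
  using frechet_derivative_at[OF has_derivative_helicoid] by metis

lemma smooth_map_helicoid: "smooth_map (helicoid lam)"
  unfolding smooth_map_def helicoid_eq_cis[abs_def] by (intro allI Ck_map_intros)

lemma smooth_map_normal_vector:
  assumes "smooth_map a"
  shows "smooth_map (\<lambda>p. normal_vector lam p (a p))"
  unfolding smooth_map_def normal_vector_def[abs_def] Complex_eq_of_real
  using assms by (intro allI Ck_map_intros Ck_map_linear_comp[OF bounded_linear_vec_nth])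
    (auto simp: smooth_map_def)

section \<open>Induced metric, orthonormal frame and normal coordinates\<close>

lemma inner_mult_cis: "(z * cis t) \<bullet> (w * cis t) = z \<bullet> w"
proof -
  have "(z * cis t) \<bullet> (w * cis t) = (z \<bullet> w) * ((cos t)\<^sup>2 + (sin t)\<^sup>2)"
    unfolding inner_complex_def times_complex.sel cis.sel by algebra
  then show ?thesis by simp
qed

lemma inner_Complex: "z \<bullet> Complex x y = Re z * x + Im z * y"
  by (simp add: inner_complex_def)

text \<open>The squared length of the tangent vector in the \<open>None\<close> direction.\<close>

definition stretch :: "real ^ 'k \<Rightarrow> real ^ ('k option) \<Rightarrow> real" where
  "stretch lam p = 1 + (\<Sum>j\<in>UNIV. (lam $ j * p $ Some j)\<^sup>2)"

lemma stretch_pos: "0 < stretch lam p"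
  by (simp add: stretch_def add_pos_nonneg sum_nonneg)

lemma inner_vec_cis:
  "((\<chi> j. z j * cis (\<theta> j)), t) \<bullet> ((\<chi> j. w j * cis (\<theta> j)), t') = (\<Sum>j\<in>UNIV. z j \<bullet> w j) + t * t'"
  by (simp add: inner_vec_def inner_mult_cis)

text \<open>With the rotation removed, each \<open>Some j\<close> direction is real and the
  \<open>None\<close> direction is imaginary in every complex factor, so the metric is
  diagonal.\<close>

lemma inner_helicoid_D:
  "helicoid_D lam p v \<bullet> helicoid_D lam p w =
     (\<Sum>j\<in>UNIV. v $ Some j * w $ Some j) + stretch lam p * (v $ None * w $ None)"
  unfolding helicoid_D_def inner_vec_cis inner_Complex stretch_def
  by (simp add: sum.distrib sum_distrib_left sum_distrib_right power2_eq_square algebra_simps)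

text \<open>As the metric is diagonal, only the \<open>None\<close> direction needs rescaling. The
  frame depends continuously on \<open>lam\<close> and \<open>p\<close>, unlike an arbitrary choice
  by \<open>SOME\<close>.\<close>

definition helicoid_frame :: "real ^ 'k \<Rightarrow> real ^ ('k option) \<Rightarrow> 'k option \<Rightarrow> real ^ ('k option)" where
  "helicoid_frame lam p i = (case i of None \<Rightarrow> (1 / sqrt (stretch lam p)) *\<^sub>R axis None 1 | Some j \<Rightarrow> axis i 1)"

lemma orthonormal_helicoid_frame:
  "orthonormal_tangent_frame (helicoid lam) p (helicoid_frame lam p)"
proof -
  have s: "stretch lam p * (1 / sqrt (stretch lam p) * (1 / sqrt (stretch lam p))) = 1"
    using stretch_pos[of lam p] by (simp add: field_simps)
  show ?thesis
    unfolding orthonormal_tangent_frame_def differential_helicoid inner_helicoid_D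
    using s by (auto simp: helicoid_frame_def axis_def if_distrib if_distribR
        split: option.split cong: if_cong)
qed

lemma normal_vector_normal: "normal_vector lam p a \<in> normal_space_at (helicoid lam) p"
proof -
  have "normal_vector lam p a \<bullet> helicoid_D lam p v = 0" for v
    unfolding normal_vector_def helicoid_D_def inner_vec_cis inner_Complex
    by (simp add: sum_distrib_left mult_ac)
  then show ?thesis
    by (auto simp: normal_space_at_def orthogonal_comp_def orthogonal_def tangent_space_def
        differential_helicoid inner_commute)
qed

definition normal_coords ::
    "real ^ 'k \<Rightarrow> real ^ ('k option) \<Rightarrow> (complex ^ 'k) \<times> real \<Rightarrow> real ^ 'k" where
  "normal_coords lam p w = (\<chi> j. Im (fst w $ j * cis (- (lam $ j * p $ None))))"

lemma normal_vector_normal_coords: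
  assumes "w \<in> normal_space_at (helicoid lam) p"
  shows "normal_vector lam p (normal_coords lam p w) = w"
proof -
  define z where "z j = fst w $ j * cis (- (lam $ j * p $ None))" for j
  have w: "w = (\<chi> j. z j * cis (lam $ j * p $ None), snd w)"
    by (simp add: z_def cis_mult mult.assoc prod_eq_iff vec_eq_iff)
  have orth: "w \<bullet> helicoid_D lam p v = 0" for v
    using assms by (auto simp: normal_space_at_def orthogonal_comp_def orthogonal_def
        tangent_space_def differential_helicoid inner_commute)
  have inner: "w \<bullet> helicoid_D lam p v =
      (\<Sum>j\<in>UNIV. Re (z j) * v $ Some j + Im (z j) * (lam $ j * p $ Some j * v $ None)) +
      snd w * v $ None" for v
    by (subst w) (simp only: helicoid_D_def inner_vec_cis inner_Complex complex.sel)
  \<comment> \<open>The direction \<open>Some j\<close> isolates the real part of the rotated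
    component; the direction \<open>None\<close> then forces the last coordinate.\<close>
  have Re: "Re (z j) = 0" for j
    using orth[of "axis (Some j) 1"] unfolding inner by (simp add: axis_def if_distrib if_distribR cong: if_cong)
  have "snd w = - (\<Sum>j\<in>UNIV. Im (z j) * lam $ j * p $ Some j)"
    using orth[of "axis None 1"] unfolding inner by (simp add: axis_def mult.assoc)
  moreover have "normal_coords lam p w = (\<chi> j. Im (z j))"
    by (simp add: normal_coords_def z_def)
  moreover have "Complex 0 (Im (z j)) = z j" for j
    by (simp add: complex_eq_iff Re)
  ultimately show ?thesis
    by (subst w) (simp add: normal_vector_def)
qed

lemma smooth_map_normal_coords:
  assumes "smooth_map V"
  shows "smooth_map (\<lambda>p. normal_coords lam p (V p))"
proof -
  have "Ck_map n (\<lambda>p. fst (V p) $ j)" for n j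
    using assms by (intro Ck_map_linear_comp[OF bounded_linear_vec_nth]
        Ck_map_linear_comp[OF bounded_linear_fst]) (simp add: smooth_map_def)
  then show ?thesis
    unfolding smooth_map_def normal_coords_def[abs_def]
    by (intro allI Ck_map_intros Ck_map_linear_comp[OF bounded_linear_Im])
qed

section \<open>Continuity of the second variation\<close>

lemma continuous_on_Complex [continuous_intros]:
  "continuous_on S f \<Longrightarrow> continuous_on S g \<Longrightarrow> continuous_on S (\<lambda>x. Complex (f x) (g x))"
  unfolding Complex_eq_of_real by (intro continuous_intros)

lemma continuous_on_stretch [continuous_intros]:
  assumes "continuous_on S f" "continuous_on S g"
  shows "continuous_on S (\<lambda>x. stretch (f x) (g x))"
  unfolding stretch_def using assms by (intro continuous_intros)

lemma continuous_on_helicoid_D [continuous_intros]: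
  assumes "continuous_on S f" "continuous_on S g" "continuous_on S h"
  shows "continuous_on S (\<lambda>x. helicoid_D (f x) (g x) (h x))"
  unfolding helicoid_D_def using assms by (intro continuous_intros)

lemma continuous_on_helicoid_D2 [continuous_intros]:
  assumes "continuous_on S f" "continuous_on S g" "continuous_on S h" "continuous_on S k"
  shows "continuous_on S (\<lambda>x. helicoid_D2 (f x) (g x) (h x) (k x))"
  unfolding helicoid_D2_def using assms by (intro continuous_intros)

lemma continuous_on_normal_vector [continuous_intros]:
  assumes "continuous_on S f" "continuous_on S g" "continuous_on S h"
  shows "continuous_on S (\<lambda>x. normal_vector (f x) (g x) (h x))"
  unfolding normal_vector_def using assms by (intro continuous_intros)

lemma continuous_on_normal_vector_D [continuous_intros]:
  assumes "continuous_on S f" "continuous_on S g" "continuous_on S h" "continuous_on S k" "continuous_on S l"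
  shows "continuous_on S (\<lambda>x. normal_vector_D (f x) (g x) (h x) (k x) (l x))"
  unfolding normal_vector_D_def using assms by (intro continuous_intros)

lemma continuous_on_helicoid_frame [continuous_intros]:
  assumes "continuous_on S f" "continuous_on S g"
  shows "continuous_on S (\<lambda>x. helicoid_frame (f x) (g x) i)"
  using assms
  by (cases i) (auto simp: helicoid_frame_def less_imp_neq[OF stretch_pos, symmetric] intro!: continuous_intros)

text \<open>An explicit projection in place of the description by \<open>THE\<close>, so that joint
  continuity in all arguments can be read off.\<close>

definition helicoid_normal_part ::
    "real ^ 'k \<Rightarrow> real ^ ('k option) \<Rightarrow> (complex ^ 'k) \<times> real \<Rightarrow> (complex ^ 'k) \<times> real" where
  "helicoid_normal_part lam p w =
     w - (\<Sum>i\<in>UNIV. (w \<bullet> helicoid_D lam p (helicoid_frame lam p i)) *\<^sub>R helicoid_D lam p (helicoid_frame lam p i))"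

lemma normal_part_helicoid: "normal_part (helicoid lam) p = helicoid_normal_part lam p"
  using normal_part_frame[OF _ orthonormal_helicoid_frame, of lam p]
    has_derivative_linear[OF has_derivative_helicoid, of lam p]
  by (simp add: fun_eq_iff helicoid_normal_part_def differential_helicoid)

lemma continuous_on_helicoid_normal_part [continuous_intros]:
  assumes "continuous_on S f" "continuous_on S g" "continuous_on S h"
  shows "continuous_on S (\<lambda>x. helicoid_normal_part (f x) (g x) (h x))"
  unfolding helicoid_normal_part_def using assms by (intro continuous_intros)

definition helicoid_integrand ::
    "real ^ 'k \<Rightarrow> real ^ ('k option) \<Rightarrow> real ^ 'k \<Rightarrow> (real ^ ('k option) \<Rightarrow> real ^ 'k) \<Rightarrow> real" where
  "helicoid_integrand lam p a b =
     ((\<Sum>i\<in>UNIV. (norm (helicoid_normal_part lam p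
         (normal_vector_D lam p a (helicoid_frame lam p i) (b (helicoid_frame lam p i)))))\<^sup>2) -
      (\<Sum>i\<in>UNIV. \<Sum>k\<in>UNIV. (helicoid_normal_part lam p
         (helicoid_D2 lam p (helicoid_frame lam p i) (helicoid_frame lam p k)) \<bullet> normal_vector lam p a)\<^sup>2)) *
     sqrt (det (gram_matrix (helicoid lam) p))"

text \<open>Independence of the frame allows \<open>helicoid_frame\<close> to replace the chosen
  one; the rest is substitution of the explicit derivatives.\<close>

lemma second_variation_helicoid:
  assumes a: "smooth_map a"
  shows "second_variation (helicoid lam) (\<lambda>p. normal_vector lam p (a p)) =
    (LINT p|lborel. helicoid_integrand lam p (a p) (frechet_derivative a (at p)))"
proof -
  have "(a has_derivative frechet_derivative a (at p)) (at p)" for p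
    using smooth_map_differentiable[OF a] frechet_derivative_works by blast
  then have "differential (\<lambda>p. normal_vector lam p (a p)) p =
      (\<lambda>v. normal_vector_D lam p (a p) v (frechet_derivative a (at p) v))" for p
    using frechet_derivative_at[OF has_derivative_normal_vector] by metis
  moreover have "differential (\<lambda>p. helicoid_D lam p w) p = (\<lambda>v. helicoid_D2 lam p v w)" for p w
    using frechet_derivative_at[OF has_derivative_helicoid_D] by metis
  ultimately show ?thesis
    unfolding second_variation_def helicoid_integrand_def
      second_variation_integrand_eq[OF smooth_map_helicoid smooth_map_normal_vector[OF a]
        orthonormal_helicoid_frame]
    by (simp only: frame_integrand_def normal_connection_def second_fundamental_form_def
        normal_part_helicoid differential_helicoid)
qed

lemma linear_eq_sum_axis:
  fixes f :: "real ^ 'm \<Rightarrow> 'b::real_normed_vector"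
  assumes "linear f"
  shows "f v = (\<Sum>i\<in>UNIV. v $ i *\<^sub>R f (axis i 1))"
proof -
  have "f v = f (\<Sum>i\<in>UNIV. v $ i *\<^sub>R axis i 1)"
    using basis_expansion[of v] by (simp add: scalar_mult_eq_scaleR)
  then show ?thesis
    by (simp add: linear_sum[OF assms] linear_scale[OF assms])
qed

lemma smooth_map_continuous: "smooth_map f \<Longrightarrow> continuous_on UNIV f"
  unfolding smooth_map_def using Ck_map.simps(1) by blast

lemma continuous_on_helicoid_integrand:
  fixes a :: "real ^ ('k option) \<Rightarrow> real ^ 'k"
  assumes a: "smooth_map a"
  shows "continuous_on UNIV (\<lambda>(lam, p). helicoid_integrand lam p (a p) (frechet_derivative a (at p)))"
proof -
  let ?a' = "\<lambda>p. frechet_derivative a (at p)"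
  have lin: "linear (?a' p)" for p
    by (intro linear_frechet_derivative smooth_map_differentiable a)
  have a_cont: "continuous_on S (\<lambda>x. a (f x))" if "continuous_on S f"
    for S :: "((real ^ 'k) \<times> (real ^ ('k option))) set" and f
    by (rule continuous_on_compose2[OF smooth_map_continuous[OF a] that subset_UNIV])
  have a'_axis: "continuous_on S (\<lambda>x. ?a' (f x) v)" if "continuous_on S f"
    for S :: "((real ^ 'k) \<times> (real ^ ('k option))) set" and f v
    by (rule continuous_on_compose2[OF smooth_map_continuous[OF smooth_map_differential[OF a]] that
          subset_UNIV])
  have a'_cont: "continuous_on S (\<lambda>x. ?a' (f x) (g x))" if "continuous_on S f" "continuous_on S g"
    for S :: "((real ^ 'k) \<times> (real ^ ('k option))) set" and f g
  proof -
    \<comment> \<open>Smoothness gives continuity of the derivative only for a fixed direction,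
      whereas the frame vectors move with \<open>lam\<close> and \<open>p\<close>. Expanding the
      direction in the standard basis gives joint continuity.\<close>
    have "(\<lambda>x. ?a' (f x) (g x)) = (\<lambda>x. \<Sum>i\<in>UNIV. g x $ i *\<^sub>R ?a' (f x) (axis i 1))"
      by (intro ext linear_eq_sum_axis lin)
    then show ?thesis by (simp only:) (intro continuous_intros a'_axis that)
  qed
  \<comment> \<open>Expanding the determinant over permutations leaves sums and products of
    continuous terms.\<close>
  show ?thesis
    unfolding case_prod_unfold helicoid_integrand_def det_def gram_matrix_def differential_helicoid
      vec_lambda_beta
    by (intro continuous_intros a_cont a'_cont)
qed

lemma helicoid_integrand_zero:
  "helicoid_integrand lam p 0 (\<lambda>_. 0) = 0"
proof -
  have "normal_vector_D lam p 0 v 0 = 0" for v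
    by (simp add: normal_vector_D_def prod_eq_iff vec_eq_iff complex_eq_iff)
  moreover have "normal_vector lam p 0 = 0"
    by (simp add: normal_vector_def prod_eq_iff vec_eq_iff complex_eq_iff)
  moreover have "helicoid_normal_part lam p 0 = 0"
    by (simp add: helicoid_normal_part_def)
  ultimately show ?thesis
    by (simp add: helicoid_integrand_def)
qed

text \<open>The coefficient function confines the integrand to one box for all \<open>lam\<close>,
  so this is continuity of a parameter integral over a compact set.\<close>

lemma continuous_on_second_variation_helicoid:
  fixes a :: "real ^ ('k option) \<Rightarrow> real ^ 'k"
  assumes a: "smooth_map a" and K: "compact (closure {p. a p \<noteq> 0})"
  shows "continuous_on UNIV (\<lambda>lam. second_variation (helicoid lam) (\<lambda>p. normal_vector lam p (a p)))"
proof -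
  define G where "G lam p = helicoid_integrand lam p (a p) (frechet_derivative a (at p))" for lam p
  have cont: "continuous_on UNIV (\<lambda>(lam, p). G lam p)"
    unfolding G_def by (rule continuous_on_helicoid_integrand[OF a])
  obtain c d where cd: "closure {p. a p \<noteq> 0} \<subseteq> cbox c d"
    using K compact_imp_bounded bounded_subset_cbox_symmetric by metis
  have G0: "G lam p = 0" if "p \<notin> cbox c d" for lam p
  proof -
    \<comment> \<open>The complement of the closure is open, so \<open>a\<close> vanishes near
      \<open>p\<close> and its derivative at \<open>p\<close> vanishes too.\<close>
    have p: "p \<in> - closure {p. a p \<noteq> 0}" using that cd by blast
    have "((\<lambda>_. 0) has_derivative (\<lambda>_. 0)) (at p)" by simp
    then have "(a has_derivative (\<lambda>_. 0)) (at p)"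
      by (rule has_derivative_transform_within_open[OF _ _ p])
        (use closure_subset[of "{p. a p \<noteq> 0}"] in auto)
    then have "frechet_derivative a (at p) = (\<lambda>_. 0)"
      using frechet_derivative_at by metis
    moreover have "a p = 0" using p closure_subset[of "{p. a p \<noteq> 0}"] by blast
    ultimately show ?thesis
      by (simp add: G_def helicoid_integrand_zero)
  qed
  have "second_variation (helicoid lam) (\<lambda>p. normal_vector lam p (a p)) = integral (cbox c d) (G lam)"
    for lam
  proof -
    \<comment> \<open>Passing from the Lebesgue integral to \<open>integral\<close> over the box
      makes \<open>integral_continuous_on_param\<close> applicable.\<close>
    have "continuous_on (cbox c d) (G lam)"
      using continuous_on_compose2[OF cont, of "cbox c d" "\<lambda>p. (lam, p)"]
      by (simp add: continuous_on_Pair continuous_on_const continuous_on_id)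
    then have "set_integrable lborel (cbox c d) (G lam)"
      unfolding set_integrable_def by (intro borel_integrable_compact compact_cbox)
    from set_borel_integral_eq_integral(2)[OF this]
    have "(LINT p|lborel. indicator (cbox c d) p *\<^sub>R G lam p) = integral (cbox c d) (G lam)"
      by (simp only: set_lebesgue_integral_def)
    moreover have "indicator (cbox c d) p *\<^sub>R G lam p = G lam p" for p
      by (auto simp: indicator_def G0)
    ultimately show ?thesis
      by (simp only: second_variation_helicoid[OF a] flip: G_def)
  qed
  moreover have "continuous_on UNIV (\<lambda>lam. integral (cbox c d) (G lam))"
    by (rule integral_continuous_on_param) (rule continuous_on_subset[OF cont], simp)
  ultimately show ?thesis by simp
qed

section \<open>Transfer of variations between helicoids, and openness\<close>

lemma admissible_normal_vector:
  assumes "smooth_map a" and K: "compact (closure {p. a p \<noteq> 0})"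
  shows "admissible_variation (helicoid lam) (\<lambda>p. normal_vector lam p (a p))"
proof -
  have "normal_vector lam p 0 = 0" for p
    by (simp add: normal_vector_def prod_eq_iff vec_eq_iff complex_eq_iff)
  then have "{p. normal_vector lam p (a p) \<noteq> 0} \<subseteq> {p. a p \<noteq> 0}"
    by auto
  then have "compact (closure {p. normal_vector lam p (a p) \<noteq> 0})"
    using K bounded_subset unfolding compact_closure by blast
  then show ?thesis
    using assms by (simp add: admissible_variation_def smooth_map_normal_vector normal_vector_normal)
qed

text \<open>The coefficient function is \<open>normal_coords\<close> applied to \<open>V\<close>; it
  vanishes where \<open>V\<close> does, so its support stays compact.\<close>

lemma admissible_variation_helicoidE:
  assumes "admissible_variation (helicoid lam) V"
  obtains a where "smooth_map a" "compact (closure {p. a p \<noteq> 0})" "V = (\<lambda>p. normal_vector lam p (a p))"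
proof
  let ?a = "\<lambda>p. normal_coords lam p (V p)"
  have V: "smooth_map V" "compact (closure {p. V p \<noteq> 0})" "\<And>p. V p \<in> normal_space_at (helicoid lam) p"
    using assms by (auto simp: admissible_variation_def)
  show "smooth_map ?a" by (rule smooth_map_normal_coords[OF V(1)])
  have "normal_coords lam p 0 = 0" for p
    by (simp add: normal_coords_def vec_eq_iff)
  then have "{p. ?a p \<noteq> 0} \<subseteq> {p. V p \<noteq> 0}"
    by auto
  then show "compact (closure {p. ?a p \<noteq> 0})"
    using V(2) bounded_subset unfolding compact_closure by blast
  show "V = (\<lambda>p. normal_vector lam p (?a p))"
    using V(3) by (simp add: normal_vector_normal_coords)
qed

lemma open_unstable_helicoid: "open {lam :: real ^ 'k. unstable (helicoid lam)}"
proof (subst open_subopen, intro ballI)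
  fix lam0 :: "real ^ 'k" assume "lam0 \<in> {lam. unstable (helicoid lam)}"
  then obtain V where "admissible_variation (helicoid lam0) V" and neg: "second_variation (helicoid lam0) V < 0"
    by (auto simp: stable_def not_le)
  then obtain a where a: "smooth_map a" "compact (closure {p. a p \<noteq> 0})"
    and V: "V = (\<lambda>p. normal_vector lam0 p (a p))"
    using that by (blast elim!: admissible_variation_helicoidE)
  \<comment> \<open>The coefficients \<open>a\<close> of the destabilizing field at
    \<open>lam0\<close> serve as a test variation for every \<open>lam\<close>.\<close>
  let ?T = "{lam. second_variation (helicoid lam) (\<lambda>p. normal_vector lam p (a p)) < 0}"
  have "open ?T"
    by (intro open_Collect_less continuous_on_second_variation_helicoid a continuous_on_const)
  moreover have "lam0 \<in> ?T" using neg V by simp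
  moreover have "?T \<subseteq> {lam. unstable (helicoid lam)}"
    using admissible_normal_vector[OF a] by (auto simp: stable_def not_le)
  ultimately show "\<exists>T. open T \<and> lam0 \<in> T \<and> T \<subseteq> {lam. unstable (helicoid lam)}" by blast
qed

theorem proposition7p5:
  shows "openin (top_of_set {lam :: real ^ 'k. \<forall>j. 0 < lam $ j})
           {lam :: real ^ 'k. (\<forall>j. 0 < lam $ j) \<and> unstable (helicoid lam)}"
  unfolding openin_open using open_unstable_helicoid by blast

end
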